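(* Let $D$ be the finite set of participants of the exchange of a central counterparty (CCP) before the instant default of a clearing member $d\in D$, and let $D'$ be the finite nonempty set of participants after the default. Assume $(R_i,P)\sim\mathcal{N}_{m+1}(\mu_i,\Gamma_i)$ for $i\in D\cup D'$, that $\Gamma=\mathbb{C}\mathrm{ov}(P)$ is invertible, and that each $i\in D\cup D'$ uses the entropic risk measure $\rho_i(L)=\frac1{\varrho_i}\ln(\mathbb{E}[\exp(\varrho_iL)])$ with $\varrho_i>0$. If the CCP liquidates the defaulter's position $\mathbf{q}_d$ on its own exchange, then $\mathrm{LC}_D=0$ and $$\mathrm{MC}_D=\frac12\varrho'\,\mathbf{q}_d^\top\Gamma\mathbf{q}_d-\varrho'\Big[\Gamma^{-1}\sum_{j\in D'\setminus D}\Big(\frac{\varrho}{\varrho_j}\mathrm{cov}-\mathrm{cov}_j\Big)\Big]^\top\Big(\mathrm{cov}'+\frac12\Gamma\mathbf{q}_d\Big)+\sum_{j\in D'\setminus D}\Big(\Gamma^{-1}(\varrho\,\mathrm{cov}-\varrho_j\mathrm{cov}_j)\Big)^\top\Big(\mathrm{cov}_j+\frac12\Gamma\mathbf{q}'_j\Big),$$ where $\varrho=\big(\sum_{i\in D}\frac1{\varrho_i}\big)^{-1}$, $\varrho'=\big(\sum_{i\in D'}\frac1{\varrho_i}\big)^{-1}$, $\mathrm{cov}=\sum_{i\in D}\mathrm{cov}_i$, $\mathrm{cov}'=\sum_{i\in D'}\mathrm{cov}_i$.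
   Context: Random variables live on a probability space; $R_i$ is real valued (receivable of participant $i$), $P$ takes values in $\mathbb{R}^m$, $m\ge1$; $\mathrm{cov}_i=(\mathbb{C}\mathrm{ov}(R_i,P_1),\dots,\mathbb{C}\mathrm{ov}(R_i,P_m))\in\mathbb{R}^m$. $\mathcal{N}_n(\mu,\Gamma)$ is the $n$-variate Gaussian law with mean $\mu$ and covariance $\Gamma$. The set $D'$ consists of the survivors $D\setminus\{d\}$ together with possible new participants $D'\setminus D$ (in particular $d\notin D'$; in the liquidation case the CCP is not itself a participant). Receivables, $P$ and risk measures are unaffected by the default. Radner equilibrium on a finite set $F$ of participants: $(\mathbf{q}_i)_{i\in F}$ in $\mathbb{R}^m$ and $\mathbf{p}\in\mathbb{R}^m$ such that for every $i\in F$ and $q_i\in\mathbb{R}^m$, $\rho_i(-R_i+\mathbf{q}_i^\top(\mathbf{p}-P))\le\rho_i(-R_i+q_i^\top(\mathbf{p}-P))$, and $\sum_{i\in F}\mathbf{q}_i=0$. The pre-default equilibrium $((\mathbf{q}_i)_{i\in D},\mathbf{p}^D)$ is the Radner equilibrium on $D$. When the CCP liquidates $\mathbf{q}_d$ on its own exchange, the position $\mathbf{q}_d$ is redistributed among the participants of $D'$, i.e. $\sum_{i\in D'}(\mathbf{q}'_i-\mathbf{q}_i)=\mathbf{q}_d$ with $\mathbf{q}_i=0$ for $i\in D'\setminus D$, which amounts to $\sum_{i\in D'}\mathbf{q}'_i=0$; the post-default equilibrium $((\mathbf{q}'_i)_{i\in D'},\mathbf{p}'^D)$ is then the Radner equilibrium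 on $D'$. (Under the stated assumptions these equilibria exist and are unique.) Liquidity cost and market cost (with $\mathbf{q}_i=0$ for $i\in D'\setminus D$): $$\mathrm{LC}_D=\sum_{i\in D'}(\mathbf{q}'_i)^\top(\mathbf{p}^D-\mathbf{p}'^D),\qquad \mathrm{MC}_D=\mathrm{LC}_D+\sum_{i\in D'}\Delta\boldsymbol\rho_i,$$ $$\Delta\boldsymbol\rho_i=\rho_i\big(-R_i+(\mathbf{q}'_i)^\top(\mathbf{p}'^D-P)\big)-\rho_i\big(-R_i+\mathbf{q}_i^\top(\mathbf{p}^D-P)\big),\quad i\in D'.$$ *)

theory Defs
  imports "HOL-Probability.Probability"
begin

text \<open>
  \<open>normal_law a v\<close> is the univariate law with mean \<open>a\<close> and variance \<open>v \<ge> 0\<close>, including the degenerate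
  case \<open>v = 0\<close>, a Dirac mass.  Note that the second parameter of \<^const>\<open>normal_density\<close> is
  the standard deviation.
\<close>

definition normal_law :: "real \<Rightarrow> real \<Rightarrow> real measure" where
  "normal_law a v =
     (if v = 0 then return borel a
      else density lborel (\<lambda>x. ennreal (normal_density a (sqrt v) x)))"

text \<open>
  \<open>has_gaussian_law M X \<mu> \<Gamma>\<close> is \<open>X \<sim> N(\<mu>, \<Gamma>)\<close> under \<open>M\<close>: every linear combination \<open>u \<bullet> X\<close> is
  univariate normal with mean \<open>u \<bullet> \<mu>\<close> and variance \<open>u \<bullet> \<Gamma> u\<close>.  As \<open>\<Gamma>\<close> may be singular, no density
  on the whole space is required.
\<close>

definition has_gaussian_law ::
    "'a measure \<Rightarrow> ('a \<Rightarrow> real ^ 'n) \<Rightarrow> real ^ 'n \<Rightarrow> real ^ 'n ^ 'n \<Rightarrow> bool" where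
  "has_gaussian_law M X \<mu> \<Gamma> \<longleftrightarrow>
     X \<in> borel_measurable M \<and>
     transpose \<Gamma> = \<Gamma> \<and> (\<forall>u. 0 \<le> u \<bullet> (\<Gamma> *v u)) \<and>
     (\<forall>u. distr M borel (\<lambda>\<omega>. u \<bullet> X \<omega>) = normal_law (u \<bullet> \<mu>) (u \<bullet> (\<Gamma> *v u)))"

text \<open>
  The \<open>(m + 1)\<close>-dimensional vector \<open>(Y, P)\<close> is indexed by \<open>'m option\<close>: coordinate \<open>None\<close> holds \<open>Y\<close> and
  coordinate \<open>Some k\<close> holds \<open>P $ k\<close>.
\<close>

definition joint_vector :: "('a \<Rightarrow> real) \<Rightarrow> ('a \<Rightarrow> real ^ 'm) \<Rightarrow> 'a \<Rightarrow> real ^ ('m option)" where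
  "joint_vector Y P \<omega> = (\<chi> j. case j of None \<Rightarrow> Y \<omega> | Some k \<Rightarrow> P \<omega> $ k)"

definition covariance :: "'a measure \<Rightarrow> ('a \<Rightarrow> real) \<Rightarrow> ('a \<Rightarrow> real) \<Rightarrow> real" where
  "covariance M X Y =
     integral\<^sup>L M (\<lambda>\<omega>. (X \<omega> - integral\<^sup>L M X) * (Y \<omega> - integral\<^sup>L M Y))"

definition cov_vector :: "'a measure \<Rightarrow> ('a \<Rightarrow> real) \<Rightarrow> ('a \<Rightarrow> real ^ 'm) \<Rightarrow> real ^ 'm" where
  "cov_vector M Y P = (\<chi> k. covariance M Y (\<lambda>\<omega>. P \<omega> $ k))"

definition cov_matrix :: "'a measure \<Rightarrow> ('a \<Rightarrow> real ^ 'm) \<Rightarrow> real ^ 'm ^ 'm" where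
  "cov_matrix M P = (\<chi> k l. covariance M (\<lambda>\<omega>. P \<omega> $ k) (\<lambda>\<omega>. P \<omega> $ l))"

definition entropic_risk :: "'a measure \<Rightarrow> real \<Rightarrow> ('a \<Rightarrow> real) \<Rightarrow> real" where
  "entropic_risk M r L = 1 / r * ln (integral\<^sup>L M (\<lambda>\<omega>. exp (r * L \<omega>)))"

text \<open>Loss of a participant with receivable \<open>Y\<close> who takes the position \<open>q\<close> at price \<open>p\<close>.\<close>

definition loss :: "('a \<Rightarrow> real) \<Rightarrow> ('a \<Rightarrow> real ^ 'm) \<Rightarrow> real ^ 'm \<Rightarrow> real ^ 'm \<Rightarrow> 'a \<Rightarrow> real" where
  "loss Y P q p \<omega> = - Y \<omega> + q \<bullet> (p - P \<omega>)"

definition radner_equilibrium ::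
    "('i \<Rightarrow> ('a \<Rightarrow> real) \<Rightarrow> real) \<Rightarrow> ('i \<Rightarrow> 'a \<Rightarrow> real) \<Rightarrow> ('a \<Rightarrow> real ^ 'm) \<Rightarrow> 'i set
      \<Rightarrow> ('i \<Rightarrow> real ^ 'm) \<Rightarrow> real ^ 'm \<Rightarrow> bool" where
  "radner_equilibrium \<rho> R P F q p \<longleftrightarrow>
     (\<forall>i\<in>F. \<forall>x. \<rho> i (loss (R i) P (q i) p) \<le> \<rho> i (loss (R i) P x p)) \<and>
     (\<Sum>i\<in>F. q i) = 0"

text \<open>
  Below, \<open>F\<close> is the set of participants after the default, \<open>(q, p)\<close> and \<open>(q', p')\<close> are the positions
  and prices before and after it; \<open>q\<close> has to be extended by \<open>0\<close> to the new participants.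
\<close>

definition liquidity_cost ::
    "'i set \<Rightarrow> real ^ 'm \<Rightarrow> ('i \<Rightarrow> real ^ 'm) \<Rightarrow> real ^ 'm \<Rightarrow> real" where
  "liquidity_cost F p q' p' = (\<Sum>i\<in>F. q' i \<bullet> (p - p'))"

definition market_cost ::
    "('i \<Rightarrow> ('a \<Rightarrow> real) \<Rightarrow> real) \<Rightarrow> ('i \<Rightarrow> 'a \<Rightarrow> real) \<Rightarrow> ('a \<Rightarrow> real ^ 'm) \<Rightarrow> 'i set
      \<Rightarrow> ('i \<Rightarrow> real ^ 'm) \<Rightarrow> real ^ 'm \<Rightarrow> ('i \<Rightarrow> real ^ 'm) \<Rightarrow> real ^ 'm \<Rightarrow> real" where
  "market_cost \<rho> R P F q p q' p' =
     liquidity_cost F p q' p' +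
     (\<Sum>i\<in>F. \<rho> i (loss (R i) P (q' i) p') - \<rho> i (loss (R i) P (q i) p))"

end

theory Submission
  imports Defs
begin

text \<open>
  For Gaussian data the entropic risk of a position is a quadratic polynomial in the position, so the
  first order conditions and market clearing give \<open>\<Gamma> q\<^sub>i = (\<varrho> / \<varrho>\<^sub>i) cov - cov\<^sub>i\<close>, and the optimal
  risk is the risk of the zero position, which does not depend on the price, minus
  \<open>(\<varrho>\<^sub>i / 2) (q\<^sub>i \<bullet> \<Gamma> q\<^sub>i)\<close>.  Let \<open>Q\<^sub>i\<close> be the position optimal at the old price and \<open>W\<close> the sum of
  the \<open>Q\<^sub>j\<close> over the newcomers.  Then \<open>q'\<^sub>i - Q\<^sub>i = e / \<varrho>\<^sub>i\<close> for a common vector \<open>e\<close>, and market clearing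
  forces \<open>e = \<varrho>' (q\<^sub>d - W)\<close>.  Substituting this in both sides of the formula for the market cost
  leaves \<open>(\<varrho>' / 2) (q\<^sub>d - W) \<bullet> \<Gamma> (q\<^sub>d - W)\<close> minus the sum of \<open>(\<varrho>\<^sub>j / 2) (Q\<^sub>j \<bullet> \<Gamma> Q\<^sub>j)\<close> over the
  newcomers.
\<close>

section \<open>Exponential moments of univariate Gaussian laws\<close>

text \<open>Completing the square: tilting a normal density by \<open>exp\<close> shifts its mean by
  the variance, so the exponential moment is the constant in front.\<close>

lemma normal_density_times_exp:
  assumes "0 < s"
  shows "normal_density a s x * exp x = exp (a + s\<^sup>2 / 2) * normal_density (a + s\<^sup>2) s x"
proof -
  have "- (x - a)\<^sup>2 / (2 * s\<^sup>2) + x = a + s\<^sup>2 / 2 + - (x - (a + s\<^sup>2))\<^sup>2 / (2 * s\<^sup>2)"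
    using assms by (simp add: field_simps power2_eq_square)
  then have "exp (- (x - a)\<^sup>2 / (2 * s\<^sup>2)) * exp x
      = exp (a + s\<^sup>2 / 2) * exp (- (x - (a + s\<^sup>2))\<^sup>2 / (2 * s\<^sup>2))"
    by (simp only: exp_add [symmetric])
  then show ?thesis
    by (simp add: normal_density_def field_simps)
qed

context prob_space
begin

text \<open>The exponential moment is expressed through the expectation and variance of
  \<open>Z\<close> instead of \<open>a\<close> and \<open>v\<close>, so that it combines directly
  with covariances computed under \<open>M\<close>.\<close>

lemma normal_law_moments:
  assumes Z [measurable]: "Z \<in> borel_measurable M"
    and law: "distr M borel Z = normal_law a v" and v: "0 \<le> v"
  shows "integrable M (\<lambda>\<omega>. (Z \<omega>)\<^sup>2)"
    and "expectation (\<lambda>\<omega>. exp (Z \<omega>)) = exp (expectation Z + variance Z / 2)"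
proof -
  have "integrable M (\<lambda>\<omega>. (Z \<omega>)\<^sup>2) \<and> expectation Z = a \<and> variance Z = v
    \<and> expectation (\<lambda>\<omega>. exp (Z \<omega>)) = exp (a + v / 2)"
  proof (cases "v = 0")
    case True
    \<comment> \<open>In the degenerate case \<open>Z\<close> equals \<open>a\<close> almost surely,
      so every integrand may be replaced by a constant.\<close>
    have "AE z in return borel a. z = a"
      by (subst AE_return) auto
    then have "AE z in distr M borel Z. z = a"
      unfolding law normal_law_def if_P [OF True] .
    then have Za: "AE \<omega> in M. Z \<omega> = a"
      by (subst (asm) AE_distr_iff) auto
    have EZ: "expectation Z = expectation (\<lambda>_. a)"
      by (intro integral_cong_AE) (use Za in auto)
    have "integrable M (\<lambda>\<omega>. (Z \<omega>)\<^sup>2) \<longleftrightarrow> integrable M (\<lambda>_. a\<^sup>2)"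
      by (intro integrable_cong_AE) (use Za in auto)
    moreover have "variance Z = expectation (\<lambda>_. 0)"
      by (intro integral_cong_AE) (use Za EZ in \<open>auto simp: prob_space\<close>)
    moreover have "expectation (\<lambda>\<omega>. exp (Z \<omega>)) = expectation (\<lambda>_. exp a)"
      by (intro integral_cong_AE) (use Za in auto)
    ultimately show ?thesis
      using EZ True by (simp add: prob_space)
  next
    case False
    define s where "s = sqrt v"
    have s: "0 < s" "s\<^sup>2 = v"
      using v False by (auto simp: s_def)
    have D: "distributed M lborel Z (normal_density a s)"
      using law False by (auto simp: distributed_def normal_law_def s_def cong: distr_cong)
    have EZ: "expectation Z = a"
      using normal_distributed_expectation [OF s(1) D] .
    have VZ: "variance Z = v"
      using normal_distributed_variance [OF s(1) D] s(2) by simp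
    have exp_eq: "expectation (\<lambda>\<omega>. exp (Z \<omega>)) = (\<integral>x. normal_density a s x * exp x \<partial>lborel)"
      by (rule distributed_integral [OF D, symmetric]) auto
    have "integrable lborel (\<lambda>x. normal_density a s x * (x - a) ^ 2)"
      using integrable_normal_moment [OF s(1), of a 2] by simp
    then have "integrable M (\<lambda>\<omega>. (Z \<omega> - a)\<^sup>2)"
      by (subst (asm) distributed_integrable [OF D]) auto
    moreover have "integrable M Z"
    proof -
      have "integrable lborel (\<lambda>x. normal_density a s x * x)"
        using integrable_normal_moment_nz_1 [OF s(1)] by simp
      then show ?thesis
        by (subst (asm) distributed_integrable [OF D]) auto
    qed
    \<comment> \<open>The integrand is the plain square of \<open>Z\<close>, rewritten through the
      central square and \<open>Z\<close> itself.\<close>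
    ultimately have "integrable M (\<lambda>\<omega>. (Z \<omega> - a)\<^sup>2 + 2 * a * Z \<omega> - a\<^sup>2)"
      by auto
    then have "integrable M (\<lambda>\<omega>. (Z \<omega>)\<^sup>2)"
      by (rule Bochner_Integration.integrable_cong [THEN iffD1, rotated 2])
        (auto simp: power2_eq_square algebra_simps)
    then show ?thesis
      using EZ VZ exp_eq s by (simp add: normal_density_times_exp)
  qed
  then show "integrable M (\<lambda>\<omega>. (Z \<omega>)\<^sup>2)"
    and "expectation (\<lambda>\<omega>. exp (Z \<omega>)) = exp (expectation Z + variance Z / 2)"
    by auto
qed

end

section \<open>First order condition for quadratic functions\<close>

text \<open>Perturb \<open>q\<close> along the gradient \<open>h\<close> itself: the increment
  \<open>t * A + t\<^sup>2 * B\<close> is nonnegative for all \<open>t\<close> and zero at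
  \<open>t = 0\<close>, so its slope \<open>A = h \<bullet> h\<close> there vanishes.\<close>

lemma quadratic_minimizer:
  fixes G :: "real ^ 'm ^ 'm"
  assumes sym: "transpose G = G"
    and min: "\<And>x. q \<bullet> b + (q \<bullet> (G *v q)) / 2 \<le> x \<bullet> b + (x \<bullet> (G *v x)) / 2"
  shows "b + G *v q = 0"
proof -
  define h where "h = b + G *v q"
  define A where "A = h \<bullet> h"
  define B where "B = (h \<bullet> (G *v h)) / 2"
  have qh: "q \<bullet> (G *v h) = h \<bullet> (G *v q)"
    by (metis dot_lmul_matrix inner_commute sym transpose_matrix_vector)
  have ineq: "0 \<le> t * A + t\<^sup>2 * B" for t
  proof -
    have "0 \<le> t * (h \<bullet> b + h \<bullet> (G *v q)) + t\<^sup>2 * B"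
      using min [of "q + t *\<^sub>R h"] qh
      by (simp add: B_def matrix_vector_right_distrib matrix_vector_mult_scaleR
          inner_add_left inner_add_right power2_eq_square algebra_simps add_divide_distrib)
    then show ?thesis
      by (simp add: A_def h_def inner_add_left inner_add_right algebra_simps)
  qed
  have "((\<lambda>t. t * A + t\<^sup>2 * B) has_real_derivative A) (at 0)"
    by (auto intro!: derivative_eq_intros)
  then have "A = 0"
    by (rule DERIV_local_min [where d = 1]) (use ineq in auto)
  then show ?thesis
    by (simp add: A_def h_def)
qed

section \<open>Second moments and the variance of a position\<close>

lemma square_integrable_mult:
  fixes X Y :: "'a \<Rightarrow> real"
  assumes [measurable]: "X \<in> borel_measurable M" "Y \<in> borel_measurable M"
    and sq: "integrable M (\<lambda>\<omega>. (X \<omega>)\<^sup>2)" "integrable M (\<lambda>\<omega>. (Y \<omega>)\<^sup>2)"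
  shows "integrable M (\<lambda>\<omega>. X \<omega> * Y \<omega>)"
proof (rule Bochner_Integration.integrable_bound)
  show "integrable M (\<lambda>\<omega>. (X \<omega>)\<^sup>2 + (Y \<omega>)\<^sup>2)"
    using sq by auto
  have "\<bar>X \<omega> * Y \<omega>\<bar> \<le> (X \<omega>)\<^sup>2 + (Y \<omega>)\<^sup>2" for \<omega>
  proof -
    have "2 * \<bar>X \<omega> * Y \<omega>\<bar> \<le> (X \<omega>)\<^sup>2 + (Y \<omega>)\<^sup>2"
      using sum_squares_bound [of "\<bar>X \<omega>\<bar>" "\<bar>Y \<omega>\<bar>"] by (simp add: abs_mult mult.assoc)
    then show ?thesis
      by linarith
  qed
  then show "AE \<omega> in M. norm (X \<omega> * Y \<omega>) \<le> norm ((X \<omega>)\<^sup>2 + (Y \<omega>)\<^sup>2)"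
    by simp
qed measurable

lemma transpose_cov_matrix: "transpose (cov_matrix M P) = cov_matrix M P"
  by (simp add: transpose_def cov_matrix_def covariance_def mult.commute)

context prob_space
begin

lemma variance_scale:
  fixes X :: "'a \<Rightarrow> real"
  shows "variance (\<lambda>\<omega>. s * X \<omega>) = s\<^sup>2 * variance X"
proof -
  have "(s * X \<omega> - expectation (\<lambda>\<omega>. s * X \<omega>))\<^sup>2 = s\<^sup>2 * (X \<omega> - expectation X)\<^sup>2" for \<omega>
    by (simp add: power2_eq_square algebra_simps)
  then show ?thesis
    by simp
qed

lemma variance_add_inner:
  fixes P :: "'a \<Rightarrow> real ^ 'm"
  assumes Ym [measurable]: "Y \<in> borel_measurable M"
    and Pm [measurable]: "\<And>k. (\<lambda>\<omega>. P \<omega> $ k) \<in> borel_measurable M"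
    and Y2: "integrable M (\<lambda>\<omega>. (Y \<omega>)\<^sup>2)" and P2: "\<And>k. integrable M (\<lambda>\<omega>. (P \<omega> $ k)\<^sup>2)"
  shows "variance (\<lambda>\<omega>. Y \<omega> + x \<bullet> P \<omega>)
    = variance Y + 2 * (x \<bullet> cov_vector M Y P) + x \<bullet> (cov_matrix M P *v x)"
proof -
  \<comment> \<open>After centring, expectations of products are exactly the covariances in
    \<open>cov_vector\<close> and \<open>cov_matrix\<close>.\<close>
  define Yc where "Yc \<omega> = Y \<omega> - expectation Y" for \<omega>
  define Pc where "Pc k \<omega> = P \<omega> $ k - expectation (\<lambda>\<omega>. P \<omega> $ k)" for k \<omega>
  have Y1 [simp]: "integrable M Y"
    using square_integrable_imp_integrable [OF Ym Y2] .
  have P1 [simp]: "integrable M (\<lambda>\<omega>. P \<omega> $ k)" for k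
    using square_integrable_imp_integrable [OF Pm P2] .
  have [measurable]: "Yc \<in> borel_measurable M" "\<And>k. Pc k \<in> borel_measurable M"
    by (auto simp: Yc_def [abs_def] Pc_def [abs_def])
  have Yc2 [simp]: "integrable M (\<lambda>\<omega>. (Yc \<omega>)\<^sup>2)"
    using Y2 by (simp add: Yc_def power2_diff)
  have Pc2: "integrable M (\<lambda>\<omega>. (Pc k \<omega>)\<^sup>2)" for k
    using P2 [of k] by (simp add: Pc_def power2_diff)
  have [simp]: "integrable M (\<lambda>\<omega>. Yc \<omega> * Pc k \<omega>)" "integrable M (\<lambda>\<omega>. Pc k \<omega> * Pc l \<omega>)" for k l
    by (auto intro!: square_integrable_mult Pc2)
  have E: "expectation (\<lambda>\<omega>. Y \<omega> + x \<bullet> P \<omega>)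
      = expectation Y + (\<Sum>k\<in>UNIV. x $ k * expectation (\<lambda>\<omega>. P \<omega> $ k))"
    by (simp add: inner_vec_def)
  have sq: "(Y \<omega> + x \<bullet> P \<omega> - expectation (\<lambda>\<omega>. Y \<omega> + x \<bullet> P \<omega>))\<^sup>2
      = (Yc \<omega>)\<^sup>2 + 2 * (\<Sum>k\<in>UNIV. x $ k * (Yc \<omega> * Pc k \<omega>))
        + (\<Sum>k\<in>UNIV. x $ k * (\<Sum>l\<in>UNIV. x $ l * (Pc k \<omega> * Pc l \<omega>)))" for \<omega>
  proof -
    have "Y \<omega> + x \<bullet> P \<omega> - expectation (\<lambda>\<omega>. Y \<omega> + x \<bullet> P \<omega>) = Yc \<omega> + (\<Sum>k\<in>UNIV. x $ k * Pc k \<omega>)"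
      unfolding E by (simp add: Yc_def Pc_def inner_vec_def right_diff_distrib sum_subtractf)
    moreover have "(\<Sum>k\<in>UNIV. x $ k * Pc k \<omega>)\<^sup>2
        = (\<Sum>k\<in>UNIV. x $ k * (\<Sum>l\<in>UNIV. x $ l * (Pc k \<omega> * Pc l \<omega>)))"
      by (simp add: power2_eq_square sum_product sum_distrib_left mult_ac)
    ultimately show ?thesis
      by (simp add: power2_sum sum_distrib_left mult_ac)
  qed
  have "variance (\<lambda>\<omega>. Y \<omega> + x \<bullet> P \<omega>) = expectation (\<lambda>\<omega>. (Yc \<omega>)\<^sup>2)
      + 2 * (\<Sum>k\<in>UNIV. x $ k * expectation (\<lambda>\<omega>. Yc \<omega> * Pc k \<omega>))
      + (\<Sum>k\<in>UNIV. x $ k * (\<Sum>l\<in>UNIV. x $ l * expectation (\<lambda>\<omega>. Pc k \<omega> * Pc l \<omega>)))"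
    by (simp add: sq)
  then show ?thesis
    by (simp add: Yc_def Pc_def inner_vec_def cov_vector_def cov_matrix_def covariance_def
        matrix_vector_mult_def mult.commute)
qed

section \<open>Entropic risk of a Gaussian position\<close>

text \<open>For a Gaussian exponent the logarithm of the exponential moment is the mean plus half
  the variance, which is quadratic in \<open>x\<close>. The price enters only through
  \<open>x \<bullet> p\<close>, so the risk at \<open>x = 0\<close> does not depend on it.\<close>

lemma entropic_risk_loss:
  fixes P :: "'a \<Rightarrow> real ^ 'm"
  assumes gauss: "has_gaussian_law M (joint_vector Y P) \<mu> \<Sigma>" and r: "0 < r"
  shows "entropic_risk M r (loss Y P x p) =
    r / 2 * variance Y - expectation Y
    + x \<bullet> (p - (\<chi> k. expectation (\<lambda>\<omega>. P \<omega> $ k)) + r *\<^sub>R cov_vector M Y P)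
    + r / 2 * (x \<bullet> (cov_matrix M P *v x))"
proof -
  define X where "X = joint_vector Y P"
  have Xm [measurable]: "X \<in> borel_measurable M"
    and law: "\<And>u. distr M borel (\<lambda>\<omega>. u \<bullet> X \<omega>) = normal_law (u \<bullet> \<mu>) (u \<bullet> (\<Sigma> *v u))"
    and pos: "\<And>u. 0 \<le> u \<bullet> (\<Sigma> *v u)"
    using gauss by (auto simp: has_gaussian_law_def X_def)
  have sq: "integrable M (\<lambda>\<omega>. (u \<bullet> X \<omega>)\<^sup>2)"
    and expo: "expectation (\<lambda>\<omega>. exp (u \<bullet> X \<omega>))
      = exp (expectation (\<lambda>\<omega>. u \<bullet> X \<omega>) + variance (\<lambda>\<omega>. u \<bullet> X \<omega>) / 2)" for u
    using normal_law_moments [OF _ law pos] by auto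
  \<comment> \<open>Testing the law against unit vectors makes each coordinate measurable and square
    integrable.\<close>
  have XY: "axis None 1 \<bullet> X \<omega> = Y \<omega>" and XP: "axis (Some k) 1 \<bullet> X \<omega> = P \<omega> $ k" for \<omega> k
    by (simp_all add: inner_axis' X_def joint_vector_def)
  have "(\<lambda>\<omega>. u \<bullet> X \<omega>) \<in> borel_measurable M" for u
    by measurable
  from this [of "axis None 1"] this [of "axis (Some _) 1"] sq [of "axis None 1"] sq [of "axis (Some _) 1"]
  have Ym [measurable]: "Y \<in> borel_measurable M"
    and Pm [measurable]: "\<And>k. (\<lambda>\<omega>. P \<omega> $ k) \<in> borel_measurable M"
    and Y2: "integrable M (\<lambda>\<omega>. (Y \<omega>)\<^sup>2)" and P2: "\<And>k. integrable M (\<lambda>\<omega>. (P \<omega> $ k)\<^sup>2)"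
    by (simp_all only: XY XP)
  have Y1 [simp]: "integrable M Y"
    using square_integrable_imp_integrable [OF Ym Y2] .
  have P1 [simp]: "integrable M (\<lambda>\<omega>. P \<omega> $ k)" for k
    using square_integrable_imp_integrable [OF Pm P2] .
  define W where "W \<omega> = Y \<omega> + x \<bullet> P \<omega>" for \<omega>
  have EW: "expectation W = expectation Y + x \<bullet> (\<chi> k. expectation (\<lambda>\<omega>. P \<omega> $ k))"
    by (simp add: W_def [abs_def] inner_vec_def)
  have VW: "variance W = variance Y + 2 * (x \<bullet> cov_vector M Y P) + x \<bullet> (cov_matrix M P *v x)"
    unfolding W_def [abs_def] by (rule variance_add_inner [OF Ym Pm Y2 P2])
  \<comment> \<open>The direction is chosen so that \<open>u \<bullet> X \<omega>\<close> is the
    random part of the scaled loss, \<open>r * loss Y P x p \<omega>\<close>.\<close>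
  define u :: "real ^ 'm option" where "u = (\<chi> j. case j of None \<Rightarrow> - r | Some k \<Rightarrow> - r * x $ k)"
  have uX: "u \<bullet> X \<omega> = - r * W \<omega>" for \<omega>
    by (simp add: u_def X_def joint_vector_def W_def inner_vec_def UNIV_option_conv sum.reindex
        sum_distrib_left distrib_left mult.assoc sum_negf)
  have "expectation (\<lambda>\<omega>. exp (r * loss Y P x p \<omega>))
      = expectation (\<lambda>\<omega>. exp (r * (x \<bullet> p)) * exp (u \<bullet> X \<omega>))"
    by (simp add: uX W_def loss_def inner_diff_right algebra_simps flip: exp_add)
  also have "\<dots> = exp (r * (x \<bullet> p) - r * expectation W + r\<^sup>2 * variance W / 2)"
    unfolding integral_mult_right_zero expo unfolding uX variance_scale
    by (simp flip: exp_add)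
  finally have "entropic_risk M r (loss Y P x p)
      = (r * (x \<bullet> p) - r * expectation W + r\<^sup>2 * variance W / 2) / r"
    by (simp add: entropic_risk_def)
  also have "\<dots> = x \<bullet> p - expectation W + r / 2 * variance W"
    using r by (simp add: field_simps power2_eq_square)
  \<comment> \<open>The order matters: unfolding \<open>EW\<close> first would rewrite the mean
    inside \<open>variance W\<close> and hide the pattern of \<open>VW\<close>.\<close>
  finally show ?thesis
    unfolding VW unfolding EW by (simp add: inner_diff_right inner_add_right algebra_simps)
qed

section \<open>Radner equilibria under entropic risk\<close>

text \<open>All first order conditions share the vector \<open>b\<close>, the price net of the mean
  of \<open>P\<close>. Divided by \<open>r j\<close> and summed, they determine \<open>b\<close>,
  since market clearing cancels the positions.\<close>

lemma radner_equilibrium_entropic: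
  fixes P :: "'a \<Rightarrow> real ^ 'm"
  assumes F: "finite F" "F \<noteq> {}"
    and gauss: "\<And>i. i \<in> F \<Longrightarrow> has_gaussian_law M (joint_vector (R i) P) (\<mu> i) (\<Sigma> i)"
    and r: "\<And>i. i \<in> F \<Longrightarrow> 0 < r i"
    and \<rho>: "\<And>i. i \<in> F \<Longrightarrow> \<rho> i = entropic_risk M (r i)"
    and eq: "radner_equilibrium \<rho> R P F q p"
    and i: "i \<in> F"
  shows "cov_matrix M P *v q i
      = (inverse (\<Sum>j\<in>F. 1 / r j) / r i) *\<^sub>R (\<Sum>j\<in>F. cov_vector M (R j) P) - cov_vector M (R i) P"
    and "\<rho> i (loss (R i) P (q i) p) = \<rho> i (loss (R i) P 0 p)
      - r i / 2 * (q i \<bullet> (cov_matrix M P *v q i))"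
proof -
  define G where "G = cov_matrix M P"
  define c where "c j = cov_vector M (R j) P" for j
  define b where "b = p - (\<chi> k. expectation (\<lambda>\<omega>. P \<omega> $ k))"
  define s where "s = (\<Sum>j\<in>F. 1 / r j)"
  have risk: "\<rho> j (loss (R j) P x p) = \<rho> j (loss (R j) P 0 p)
      + x \<bullet> (b + r j *\<^sub>R c j) + r j / 2 * (x \<bullet> (G *v x))" if "j \<in> F" for j x
    using entropic_risk_loss [OF gauss r, OF that that] \<rho> [OF that]
    by (simp add: b_def c_def G_def)
  have foc: "b + r j *\<^sub>R c j + r j *\<^sub>R (G *v q j) = 0" if j: "j \<in> F" for j
  proof -
    have "q j \<bullet> (b + r j *\<^sub>R c j) + (q j \<bullet> (r j *\<^sub>R G *v q j)) / 2
        \<le> x \<bullet> (b + r j *\<^sub>R c j) + (x \<bullet> (r j *\<^sub>R G *v x)) / 2" for x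
    proof -
      have "\<rho> j (loss (R j) P (q j) p) \<le> \<rho> j (loss (R j) P x p)"
        using eq j by (auto simp: radner_equilibrium_def)
      then show ?thesis
        unfolding risk [OF j, of "q j"] risk [OF j, of x]
        by (simp add: scaleR_matrix_vector_assoc [symmetric])
    qed
    moreover have "transpose (r j *\<^sub>R G) = r j *\<^sub>R G"
      by (simp add: G_def transpose_scalar transpose_cov_matrix)
    ultimately have "b + r j *\<^sub>R c j + r j *\<^sub>R G *v q j = 0"
      by (intro quadratic_minimizer)
    then show ?thesis
      by (simp add: scaleR_matrix_vector_assoc)
  qed
  have Gq: "G *v q j = - ((1 / r j) *\<^sub>R b) - c j" if j: "j \<in> F" for j
  proof -
    have "(1 / r j) *\<^sub>R (b + r j *\<^sub>R c j + r j *\<^sub>R (G *v q j)) = 0"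
      using foc [OF j] by simp
    then show ?thesis
      using r [OF j] by (simp add: scaleR_add_right eq_neg_iff_add_eq_0 algebra_simps)
  qed
  have "0 = G *v (\<Sum>j\<in>F. q j)"
    using eq by (simp add: radner_equilibrium_def)
  also have "\<dots> = (\<Sum>j\<in>F. G *v q j)"
    by (rule linear_sum) (rule matrix_vector_mul_linear)
  also have "\<dots> = - (s *\<^sub>R b) - (\<Sum>j\<in>F. c j)"
    by (simp add: Gq s_def sum_subtractf sum_negf scaleR_sum_left)
  finally have sb: "s *\<^sub>R b = - (\<Sum>j\<in>F. c j)"
    by (simp add: algebra_simps add_eq_0_iff)
  have "0 < s"
    using F r by (auto simp: s_def intro!: sum_pos)
  then have "b = inverse s *\<^sub>R (s *\<^sub>R b)"
    by simp
  then have b: "b = - (inverse s *\<^sub>R (\<Sum>j\<in>F. c j))"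
    by (simp only: sb scaleR_minus_right)
  show "cov_matrix M P *v q i
      = (inverse (\<Sum>j\<in>F. 1 / r j) / r i) *\<^sub>R (\<Sum>j\<in>F. cov_vector M (R j) P) - cov_vector M (R i) P"
    using Gq [OF i] by (simp add: b G_def c_def s_def field_simps)
  \<comment> \<open>Testing the first order condition against \<open>q i\<close> shows that the
    linear part of the risk is minus twice its quadratic part.\<close>
  have "q i \<bullet> (b + r i *\<^sub>R c i) = - (r i * (q i \<bullet> (G *v q i)))"
    using foc [OF i] by (simp add: eq_neg_iff_add_eq_0 flip: inner_add_right inner_scaleR_right)
  then show "\<rho> i (loss (R i) P (q i) p) = \<rho> i (loss (R i) P 0 p)
      - r i / 2 * (q i \<bullet> (cov_matrix M P *v q i))"
    using risk [OF i, of "q i"] by (simp add: G_def algebra_simps)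
qed

end

section \<open>Cost of liquidating the defaulter's position\<close>

theorem proposition4p1:
  fixes M :: "'a measure"
    and R :: "'i \<Rightarrow> 'a \<Rightarrow> real"
    and P :: "'a \<Rightarrow> real ^ 'm"
    and \<rho> :: "'i \<Rightarrow> ('a \<Rightarrow> real) \<Rightarrow> real"
    and r :: "'i \<Rightarrow> real"
    and \<mu> :: "'i \<Rightarrow> real ^ ('m option)"
    and \<Sigma> :: "'i \<Rightarrow> real ^ ('m option) ^ ('m option)"
    and D D' :: "'i set" and d :: 'i
    and q q' :: "'i \<Rightarrow> real ^ 'm" and p p' :: "real ^ 'm"
  assumes "prob_space M"
    and "finite D" and "d \<in> D"
    and "finite D'" and "D' \<noteq> {}" and "D - {d} \<subseteq> D'" and "d \<notin> D'"
    and "\<And>i. i \<in> D \<union> D' \<Longrightarrow> has_gaussian_law M (joint_vector (R i) P) (\<mu> i) (\<Sigma> i)"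
    and "invertible (cov_matrix M P)"
    and "\<And>i. i \<in> D \<union> D' \<Longrightarrow> r i > 0"
    and "\<And>i. i \<in> D \<union> D' \<Longrightarrow> \<rho> i = entropic_risk M (r i)"
    and "radner_equilibrium \<rho> R P D q p"
    and "\<And>i. i \<in> D' - D \<Longrightarrow> q i = 0"
    and "radner_equilibrium \<rho> R P D' q' p'"
  shows "liquidity_cost D' p q' p' = 0 \<and>
    (let \<Gamma> = cov_matrix M P;
         cov = (\<lambda>i. cov_vector M (R i) P);
         covD = (\<Sum>i\<in>D. cov i);
         covD' = (\<Sum>i\<in>D'. cov i);
         rD = inverse (\<Sum>i\<in>D. 1 / r i);
         rD' = inverse (\<Sum>i\<in>D'. 1 / r i)
     in market_cost \<rho> R P D' q p q' p' =
          1 / 2 * rD' * (q d \<bullet> (\<Gamma> *v q d))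
          - rD' * ((matrix_inv \<Gamma> *v (\<Sum>j\<in>D' - D. (rD / r j) *\<^sub>R covD - cov j))
                    \<bullet> (covD' + (1 / 2) *\<^sub>R (\<Gamma> *v q d)))
          + (\<Sum>j\<in>D' - D. (matrix_inv \<Gamma> *v (rD *\<^sub>R covD - r j *\<^sub>R cov j))
                    \<bullet> (cov j + (1 / 2) *\<^sub>R (\<Gamma> *v q' j))))"
proof
  interpret prob_space M
    by fact
  note [simp] = \<open>finite D\<close> \<open>finite D'\<close>
  define G where "G = cov_matrix M P"
  define c where "c i = cov_vector M (R i) P" for i
  define cD cD' where "cD = sum c D" and "cD' = sum c D'"
  \<comment> \<open>Here \<open>s\<close> and \<open>s'\<close> are the inverses of the sums,
    whereas \<open>s\<close> in the proof of \<open>radner_equilibrium_entropic\<close> is the sum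
    itself.\<close>
  define s s' where "s = inverse (\<Sum>i\<in>D. 1 / r i)" and "s' = inverse (\<Sum>i\<in>D'. 1 / r i)"
  define N where "N = D' - D"
  \<comment> \<open>\<open>Q i\<close> is the position that participant \<open>i\<close>, old or new, would choose at the old price \<open>p\<close>.\<close>
  define Q where "Q i = matrix_inv G *v ((s / r i) *\<^sub>R cD - c i)" for i
  define W where "W = sum Q N"
  \<comment> \<open>By the equation for \<open>b\<close> in the two equilibria,
    \<open>G *v e\<close> is the price drop \<open>p - p'\<close>.\<close>
  define e where "e = matrix_inv G *v (s' *\<^sub>R cD' - s *\<^sub>R cD)"
  \<comment> \<open>\<open>K\<close> is the risk reduction that the newcomers would obtain by
    trading optimally at the old price.\<close>
  define K where "K = (\<Sum>j\<in>N. r j / 2 * (Q j \<bullet> (G *v Q j)))"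
  have r: "0 < r i" if "i \<in> D \<union> D'" for i
    using assms that by blast
  have sum_q': "sum q' D' = 0" and sum_q: "sum q D = 0"
    using assms by (auto simp: radner_equilibrium_def)
  \<comment> \<open>The price difference is common to all summands, so market clearing annihilates
    it.\<close>
  show LC: "liquidity_cost D' p q' p' = 0"
    by (simp add: liquidity_cost_def sum_q' flip: inner_sum_left)
  have inv: "invertible G"
    using assms by (simp add: G_def)
  have invG: "matrix_inv G *v (G *v x) = x" and Ginv: "G *v (matrix_inv G *v x) = x" for x
    using someI_ex [OF inv [unfolded invertible_def]]
    by (simp_all add: matrix_vector_mul_assoc flip: matrix_inv_def)
  have sym: "x \<bullet> (G *v y) = y \<bullet> (G *v x)" for x y
    by (metis G_def dot_lmul_matrix inner_commute transpose_cov_matrix transpose_matrix_vector)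
  have GQ: "G *v Q i = (s / r i) *\<^sub>R cD - c i" for i
    by (simp add: Q_def Ginv)
  have Ge: "G *v e = s' *\<^sub>R cD' - s *\<^sub>R cD"
    by (simp add: e_def Ginv)
  have "D \<noteq> {}"
    using \<open>d \<in> D\<close> by blast
  have eqD: "G *v q i = (s / r i) *\<^sub>R cD - c i"
      "\<rho> i (loss (R i) P (q i) p) = \<rho> i (loss (R i) P 0 p) - r i / 2 * (q i \<bullet> (G *v q i))"
    if "i \<in> D" for i
    unfolding G_def c_def cD_def s_def
    by (rule radner_equilibrium_entropic [OF \<open>finite D\<close> \<open>D \<noteq> {}\<close> assms(8,10,11,12) that]; simp)+
  have eqD': "G *v q' i = (s' / r i) *\<^sub>R cD' - c i"
      "\<rho> i (loss (R i) P (q' i) p') = \<rho> i (loss (R i) P 0 p') - r i / 2 * (q' i \<bullet> (G *v q' i))"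
    if "i \<in> D'" for i
    unfolding G_def c_def cD'_def s'_def
    by (rule radner_equilibrium_entropic [OF \<open>finite D'\<close> \<open>D' \<noteq> {}\<close> assms(8,10,11,14) that]; simp)+
  have q_eq: "q i = Q i" if "i \<in> D" for i
    using invG [of "q i"] by (simp add: Q_def eqD that)
  have q'_eq: "q' i = Q i + (1 / r i) *\<^sub>R e" if "i \<in> D'" for i
  proof -
    have "G *v q' i = G *v (Q i + (1 / r i) *\<^sub>R e)"
      by (simp add: eqD' that GQ Ge matrix_vector_right_distrib matrix_vector_mult_scaleR
          scaleR_diff_right)
    then show ?thesis
      by (metis invG)
  qed
  have D'_eq: "D' = (D - {d}) \<union> N"
    using assms by (auto simp: N_def)
  have split: "sum f D' = sum f (D - {d}) + sum f N" for f :: "'i \<Rightarrow> 'b::comm_monoid_add"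
    unfolding D'_eq by (rule sum.union_disjoint) (auto simp: N_def)
  \<comment> \<open>On \<open>D\<close> the \<open>Q i\<close> are the old positions, which sum to
    zero with \<open>q d\<close> included.\<close>
  have "sum Q (D - {d}) = - q d"
    using sum_q q_eq \<open>d \<in> D\<close> by (simp add: sum_diff1)
  then have sum_Q: "sum Q D' = W - q d"
    by (simp add: split W_def)
  have sum_r: "(\<Sum>i\<in>D'. 1 / r i) = inverse s'"
    by (simp add: s'_def)
  have "0 < (\<Sum>i\<in>D'. 1 / r i)"
    using r \<open>D' \<noteq> {}\<close> by (intro sum_pos) auto
  then have s': "0 < s'"
    by (simp add: s'_def)
  \<comment> \<open>Clearing after the default gives a second expression for \<open>e\<close>, now
    in terms of positions instead of covariances.\<close>
  have "0 = sum Q D' + (\<Sum>i\<in>D'. 1 / r i) *\<^sub>R e"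
    using sum_q' by (simp add: q'_eq sum.distrib scaleR_sum_left)
  then have "inverse s' *\<^sub>R e = q d - W"
    by (simp add: sum_Q sum_r algebra_simps add_eq_0_iff)
  then have "s' *\<^sub>R (inverse s' *\<^sub>R e) = s' *\<^sub>R (q d - W)"
    by simp
  then have e: "e = s' *\<^sub>R (q d - W)"
    using s' by simp
  \<comment> \<open>A survivor already had the risk reduction belonging to \<open>Q i\<close>, and
    it cancels. A newcomer starts from the zero position, so this term remains.\<close>
  have risk: "\<rho> i (loss (R i) P (q' i) p') - \<rho> i (loss (R i) P (q i) p)
      = - (Q i \<bullet> (G *v e)) - (1 / r i) * ((e \<bullet> (G *v e)) / 2)
        - (if i \<in> N then r i / 2 * (Q i \<bullet> (G *v Q i)) else 0)"
    (is "?l = ?r") if i: "i \<in> D'" for i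
  proof -
    have ri: "0 < r i"
      using r i by auto
    \<comment> \<open>The zero position involves no payment, so the baseline risk is the same at
      both prices.\<close>
    have L0: "loss (R i) P 0 p = loss (R i) P 0 p'"
      by (simp add: loss_def [abs_def])
    have "?l = (if i \<in> N then 0 else r i / 2 * (Q i \<bullet> (G *v Q i))) - r i / 2 * (q' i \<bullet> (G *v q' i))"
    proof (cases "i \<in> N")
      case True
      then have "q i = 0"
        using assms by (auto simp: N_def)
      then show ?thesis
        using True by (simp add: eqD'(2) i L0)
    next
      case False
      then have "i \<in> D"
        using i by (simp add: N_def)
      then show ?thesis
        unfolding eqD'(2) [OF i] eqD(2) [OF \<open>i \<in> D\<close>] L0
        using False by (simp add: q_eq)
    qed
    moreover have "r i / 2 * (q' i \<bullet> (G *v q' i))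
        = r i / 2 * (Q i \<bullet> (G *v Q i)) + Q i \<bullet> (G *v e) + (1 / r i) * ((e \<bullet> (G *v e)) / 2)"
      using ri
      by (simp add: q'_eq i matrix_vector_right_distrib matrix_vector_mult_scaleR inner_add_left
          inner_add_right sym [of e "Q i"] field_simps)
    ultimately show ?thesis
      by (simp only: split: if_split) linarith
  qed
  have "market_cost \<rho> R P D' q p q' p'
      = - (sum Q D' \<bullet> (G *v e)) - (\<Sum>i\<in>D'. 1 / r i) * ((e \<bullet> (G *v e)) / 2)
        - (\<Sum>i\<in>D'. if i \<in> N then r i / 2 * (Q i \<bullet> (G *v Q i)) else 0)"
    unfolding market_cost_def LC
    by (simp only: risk sum_subtractf sum_negf inner_sum_left sum_distrib_right add_0_left cong: sum.cong)
  also have "(\<Sum>i\<in>D'. if i \<in> N then r i / 2 * (Q i \<bullet> (G *v Q i)) else 0) = K"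
    unfolding K_def by (rule sum.mono_neutral_cong_right) (auto simp: N_def)
  \<comment> \<open>As \<open>e = s' *\<^sub>R (q d - W)\<close>, the second term is half of the
    first with opposite sign.\<close>
  also have "- (sum Q D' \<bullet> (G *v e)) - (\<Sum>i\<in>D'. 1 / r i) * ((e \<bullet> (G *v e)) / 2) - K
      = (q d - W) \<bullet> (G *v e) / 2 - K"
    unfolding sum_Q sum_r using s' by (simp add: e inner_diff_left field_simps)
  finally have MC: "market_cost \<rho> R P D' q p q' p' = (q d - W) \<bullet> (G *v e) / 2 - K" .
  \<comment> \<open>The last sum of the claim is treated termwise: its first factor is
    \<open>r j *\<^sub>R Q j\<close>, and \<open>GQ\<close> eliminates \<open>c j\<close> from the
    second.\<close>
  have "(matrix_inv G *v (s *\<^sub>R cD - r j *\<^sub>R c j)) \<bullet> (c j + (1 / 2) *\<^sub>R (G *v q' j))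
      = Q j \<bullet> (s *\<^sub>R cD) + (Q j \<bullet> (G *v e)) / 2 - r j / 2 * (Q j \<bullet> (G *v Q j))"
    if j: "j \<in> N" for j
  proof -
    have j': "j \<in> D'" and rj: "0 < r j"
      using j r by (auto simp: N_def)
    have "matrix_inv G *v (s *\<^sub>R cD - r j *\<^sub>R c j) = r j *\<^sub>R Q j"
      using rj by (simp add: Q_def scaleR_diff_right flip: matrix_vector_mult_scaleR)
    moreover have "c j + (1 / 2) *\<^sub>R (G *v q' j)
        = (1 / r j) *\<^sub>R (s *\<^sub>R cD) + (1 / (2 * r j)) *\<^sub>R (G *v e) - (1 / 2) *\<^sub>R (G *v Q j)"
    proof -
      have "c j = (1 / r j) *\<^sub>R (s *\<^sub>R cD) - G *v Q j"
        by (simp add: GQ)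
      moreover have "G *v Q j = (1 / 2) *\<^sub>R (G *v Q j) + (1 / 2) *\<^sub>R (G *v Q j)"
        by (simp flip: scaleR_add_left)
      ultimately show ?thesis
        by (simp add: q'_eq j' matrix_vector_right_distrib matrix_vector_mult_scaleR
            scaleR_add_right)
    qed
    ultimately have "(matrix_inv G *v (s *\<^sub>R cD - r j *\<^sub>R c j)) \<bullet> (c j + (1 / 2) *\<^sub>R (G *v q' j))
        = (r j *\<^sub>R Q j)
          \<bullet> ((1 / r j) *\<^sub>R (s *\<^sub>R cD) + (1 / (2 * r j)) *\<^sub>R (G *v e) - (1 / 2) *\<^sub>R (G *v Q j))"
      by (simp only:)
    then show ?thesis
      using rj by (simp add: inner_add_right inner_diff_right field_simps)
  qed
  then have third: "(\<Sum>j\<in>N. (matrix_inv G *v (s *\<^sub>R cD - r j *\<^sub>R c j)) \<bullet> (c j + (1 / 2) *\<^sub>R (G *v q' j)))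
      = W \<bullet> (s *\<^sub>R cD) + (W \<bullet> (G *v e)) / 2 - K"
    by (simp add: sum.distrib sum_subtractf W_def K_def inner_sum_left sum_divide_distrib sum_distrib_left
        cong: sum.cong)
  have W: "matrix_inv G *v (\<Sum>j\<in>N. (s / r j) *\<^sub>R cD - c j) = W"
    unfolding W_def Q_def by (rule linear_sum) (rule matrix_vector_mul_linear)
  \<comment> \<open>Trading \<open>cD\<close> for \<open>cD'\<close> through the definition of
    \<open>e\<close> cancels the \<open>cD'\<close> part of the second term of the claim; what is
    left is quadratic in \<open>q d\<close> and \<open>W\<close>, apart from
    \<open>K\<close>.\<close>
  have We: "W \<bullet> (s *\<^sub>R cD) = s' * (W \<bullet> cD') - W \<bullet> (G *v e)"
    by (simp add: Ge inner_diff_right)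
  have "market_cost \<rho> R P D' q p q' p' = 1 / 2 * s' * (q d \<bullet> (G *v q d))
          - s' * ((matrix_inv G *v (\<Sum>j\<in>N. (s / r j) *\<^sub>R cD - c j))
                    \<bullet> (cD' + (1 / 2) *\<^sub>R (G *v q d)))
          + (\<Sum>j\<in>N. (matrix_inv G *v (s *\<^sub>R cD - r j *\<^sub>R c j))
                    \<bullet> (c j + (1 / 2) *\<^sub>R (G *v q' j)))"
    unfolding MC W third We e
    by (simp add: matrix_vector_mult_scaleR matrix_vector_mult_diff_distrib inner_diff_left
        inner_diff_right inner_add_right sym [of "q d" W] field_simps)
  then show "let \<Gamma> = cov_matrix M P;
         cov = (\<lambda>i. cov_vector M (R i) P);
         covD = (\<Sum>i\<in>D. cov i);
         covD' = (\<Sum>i\<in>D'. cov i);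
         rD = inverse (\<Sum>i\<in>D. 1 / r i);
         rD' = inverse (\<Sum>i\<in>D'. 1 / r i)
     in market_cost \<rho> R P D' q p q' p' =
          1 / 2 * rD' * (q d \<bullet> (\<Gamma> *v q d))
          - rD' * ((matrix_inv \<Gamma> *v (\<Sum>j\<in>D' - D. (rD / r j) *\<^sub>R covD - cov j))
                    \<bullet> (covD' + (1 / 2) *\<^sub>R (\<Gamma> *v q d)))
          + (\<Sum>j\<in>D' - D. (matrix_inv \<Gamma> *v (rD *\<^sub>R covD - r j *\<^sub>R cov j))
                    \<bullet> (cov j + (1 / 2) *\<^sub>R (\<Gamma> *v q' j)))"
    unfolding Let_def G_def c_def cD_def cD'_def s_def s'_def N_def .
qed

end
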